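(* Let $D$ be a basic subset of $\Delta^+$ and let $C(D)=\{\xi_1\succ\xi_2\succ\dots\succ\xi_c\}$. Put $r_i=r_{\xi_i}$ and $w_i=r_1\cdots r_i$. Then the permutation $w_D$ decomposes into the product of reflections $$w_D=r_1r_2\cdots r_c .$$ In this decomposition, for every $1\le j\le c$: (i) $w_i(\xi_j)>0$ for all $1\le i<j$; (ii) $\xi_j\notin M(D)$; (iii) $\xi_j$ is the greatest (with respect to $\succ$) positive root that satisfies (i) and (ii) (with $\xi_j$ replaced by that root) and is less than $\xi_{j-1}$ (the last requirement being void for $j=1$).
   Context: Roots. Fix $n\ge 1$. A root is a pair $(i,j)$ with $1\le i,j\le n$, $i\ne j$; it is positive (written $>0$) if $i>j$ and negative (written $<0$) if $i<j$. $\Delta^+$ is the set of positive roots; $\mathrm{row}(i,j)=i$, $\mathrm{col}(i,j)=j$. The Weyl group $W=S_n$ acts on roots by $w(i,j)=(w(i),w(j))$; the reflection $r_\xi$ with respect to $\xi=(i,j)$ is the transposition of $i$ and $j$; products of permutations are compositions, so $(uv)(\gamma)=u(v(\gamma))$. For positive roots, $\gamma=\alpha+\beta$ means $\gamma=(i,k)$ and $\{\alpha,\beta\}=\{(i,j),(j,k)\}$ for some $i>j>k$. A subset $D\subset\Delta^+$ is basic if every row and every column contains at most one root of $D$. A positive root $\alpha$ is $D$-singular if there is a positive root $\beta$ with $\alpha+\beta\in D$; $S(D)$ is the set of $D$-singular roots, $R(D)=\Delta^+\setminus S(D)$, and $M(D)=R(D)\setminus D$. The permutation $w_D$. $w_D\in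 S_n$ is defined recursively: for $j=1,\dots,n$, $w_D(j)$ is the greatest $i\in\{1,\dots,n\}$ such that $(i,j)\notin M(D)$ and $i\notin\{w_D(1),\dots,w_D(j-1)\}$. Order and the set $C(D)$. Order $\Delta^+$ linearly by: $(k,m)\succ(i,j)$ if $m<j$, or $m=j$ and $k>i$. The diagram of $D$ is a filling of the places $(i,j)\in\Delta^+$ with symbols $\otimes,\bullet,+,-$ built as follows. Step 0: fill all places of $M(D)$ with $\bullet$. Step $i$ ($i\ge1$): let $\xi_i$ be the greatest (for $\succ$) place that is still empty; fill it with $\otimes$. For every decomposition $\xi_i=\alpha+\beta$ into positive roots with $\mathrm{col}(\alpha)=\mathrm{col}(\xi_i)$ and $\mathrm{row}(\beta)=\mathrm{row}(\xi_i)$: if both places $\alpha,\beta$ are empty, fill $\alpha$ with $+$ and $\beta$ with $-$; if one of them is already filled, do not fill the other. Continue until no place is empty. $C(D)=\{\xi_1\succ\xi_2\succ\dots\succ\xi_c\}$ is the set of places filled with $\otimes$. *)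

theory Defs
  imports "HOL-Combinatorics.Permutations" "HOL-Library.While_Combinator"
begin

text \<open>
  Elements of \<open>S\<^sub>n\<close> are functions \<open>nat \<Rightarrow> nat\<close> that permute \<open>{1..n}\<close> and
  are the identity elsewhere, as in \<^const>\<open>permutes\<close>.
\<close>

type_synonym root = "nat \<times> nat"

abbreviation row :: "root \<Rightarrow> nat" where "row \<equiv> fst"
abbreviation col :: "root \<Rightarrow> nat" where "col \<equiv> snd"

definition roots :: "nat \<Rightarrow> root set" where
  "roots n = {(i, j). i \<in> {1..n} \<and> j \<in> {1..n} \<and> i \<noteq> j}"

definition positive_root :: "root \<Rightarrow> bool" where
  "positive_root \<gamma> \<longleftrightarrow> row \<gamma> > col \<gamma>"

definition pos_roots :: "nat \<Rightarrow> root set" where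
  "pos_roots n = {\<gamma> \<in> roots n. positive_root \<gamma>}"

definition act :: "(nat \<Rightarrow> nat) \<Rightarrow> root \<Rightarrow> root" where
  "act w \<gamma> = (w (row \<gamma>), w (col \<gamma>))"

definition reflection :: "root \<Rightarrow> nat \<Rightarrow> nat" where
  "reflection \<gamma> = Transposition.transpose (row \<gamma>) (col \<gamma>)"

fun refl_prod :: "(nat \<Rightarrow> root) \<Rightarrow> nat \<Rightarrow> nat \<Rightarrow> nat" where
  "refl_prod \<xi> 0 = id"
| "refl_prod \<xi> (Suc i) = refl_prod \<xi> i \<circ> reflection (\<xi> (Suc i))"

text \<open>\<open>root_sum \<gamma> \<alpha> \<beta>\<close> means \<open>\<gamma> = \<alpha> + \<beta>\<close> for positive roots.\<close>

definition root_sum :: "root \<Rightarrow> root \<Rightarrow> root \<Rightarrow> bool" where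
  "root_sum \<gamma> \<alpha> \<beta> \<longleftrightarrow>
     (\<exists>i j k. i > j \<and> j > k \<and> \<gamma> = (i, k) \<and> {\<alpha>, \<beta>} = {(i, j), (j, k)})"

definition basic :: "nat \<Rightarrow> root set \<Rightarrow> bool" where
  "basic n D \<longleftrightarrow> D \<subseteq> pos_roots n \<and> inj_on row D \<and> inj_on col D"

definition singular_roots :: "nat \<Rightarrow> root set \<Rightarrow> root set" where
  "singular_roots n D =
     {\<alpha> \<in> pos_roots n. \<exists>\<beta> \<in> pos_roots n. \<exists>\<gamma> \<in> D. root_sum \<gamma> \<alpha> \<beta>}"

definition regular_roots :: "nat \<Rightarrow> root set \<Rightarrow> root set" where
  "regular_roots n D = pos_roots n - singular_roots n D"

definition M_set :: "nat \<Rightarrow> root set \<Rightarrow> root set" where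
  "M_set n D = regular_roots n D - D"

fun w_perm :: "nat \<Rightarrow> root set \<Rightarrow> nat \<Rightarrow> nat" where
  "w_perm n D j =
     (if j \<in> {1..n}
      then Max {i \<in> {1..n}. (i, j) \<notin> M_set n D \<and> i \<notin> w_perm n D ` {1..<j}}
      else j)"

declare w_perm.simps [simp del]

definition root_gt :: "root \<Rightarrow> root \<Rightarrow> bool" (infix "\<succ>" 50) where
  "\<alpha> \<succ> \<beta> \<longleftrightarrow> col \<alpha> < col \<beta> \<or> (col \<alpha> = col \<beta> \<and> row \<alpha> > row \<beta>)"

definition is_greatest :: "root \<Rightarrow> root set \<Rightarrow> bool" where
  "is_greatest \<alpha> A \<longleftrightarrow> \<alpha> \<in> A \<and> (\<forall>\<beta> \<in> A. \<beta> \<noteq> \<alpha> \<longrightarrow> \<alpha> \<succ> \<beta>)"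

datatype mark = Otimes | Bullet | Plus | Minus

type_synonym filling = "root \<Rightarrow> mark option"

definition empty_places :: "nat \<Rightarrow> filling \<Rightarrow> root set" where
  "empty_places n F = {\<gamma> \<in> pos_roots n. F \<gamma> = None}"

definition step0 :: "nat \<Rightarrow> root set \<Rightarrow> filling" where
  "step0 n D = (\<lambda>\<gamma>. if \<gamma> \<in> M_set n D then Some Bullet else None)"

text \<open>
  Distinct decompositions of one root \<open>\<xi>\<close> involve disjoint pairs of places, none
  of them \<open>\<xi>\<close>; so they can be processed simultaneously, and emptiness can be
  tested in the filling \<open>F\<close> at the beginning of the step.
\<close>

definition fillable :: "filling \<Rightarrow> root \<Rightarrow> root \<Rightarrow> root \<Rightarrow> bool" where
  "fillable F \<xi> \<alpha> \<beta> \<longleftrightarrow>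
     root_sum \<xi> \<alpha> \<beta> \<and> col \<alpha> = col \<xi> \<and> row \<beta> = row \<xi> \<and> F \<alpha> = None \<and> F \<beta> = None"

definition fill_step :: "nat \<Rightarrow> filling \<Rightarrow> filling" where
  "fill_step n F =
     (let \<xi> = (THE \<xi>. is_greatest \<xi> (empty_places n F)) in
      (\<lambda>\<gamma>. if \<gamma> = \<xi> then Some Otimes
           else if \<exists>\<beta>. fillable F \<xi> \<gamma> \<beta> then Some Plus
           else if \<exists>\<alpha>. fillable F \<xi> \<alpha> \<gamma> then Some Minus
           else F \<gamma>))"

definition diagram :: "nat \<Rightarrow> root set \<Rightarrow> filling" where
  "diagram n D = while (\<lambda>F. empty_places n F \<noteq> {}) (fill_step n) (step0 n D)"

definition C_set :: "nat \<Rightarrow> root set \<Rightarrow> root set" where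
  "C_set n D = {\<gamma> \<in> pos_roots n. diagram n D \<gamma> = Some Otimes}"

lemma finite_pos_roots [simp]: "finite (pos_roots n)"
  by (rule finite_subset [of _ "{1..n} \<times> {1..n}"]) (auto simp: pos_roots_def roots_def)

lemma decreasing_enumeration:
  assumes "finite A"
  shows "\<exists>(c::nat) \<xi>. A = \<xi> ` {1..c} \<and> (\<forall>i j. 1 \<le> i \<and> i < j \<and> j \<le> c \<longrightarrow> \<xi> i \<succ> \<xi> j)"
proof -
  obtain N where N: "\<And>\<alpha>. \<alpha> \<in> A \<Longrightarrow> row \<alpha> \<le> N"
    using assms by (meson finite_imageI finite_nat_set_iff_bounded_le image_eqI)
  define f where "f = (\<lambda>\<alpha>::root. col \<alpha> * (N + 1) + (N - row \<alpha>))"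
  have gt: "\<alpha> \<succ> \<beta>" if "\<alpha> \<in> A" "\<beta> \<in> A" "f \<alpha> < f \<beta>" for \<alpha> \<beta>
  proof (rule ccontr)
    assume "\<not> \<alpha> \<succ> \<beta>"
    then consider "col \<beta> < col \<alpha>" | "col \<alpha> = col \<beta>" "row \<alpha> \<le> row \<beta>"
      unfolding root_gt_def by linarith
    then show False
    proof cases
      case 1
      then have "(col \<beta> + 1) * (N + 1) \<le> col \<alpha> * (N + 1)"
        by (intro mult_le_mono) auto
      then show ?thesis using that(3) by (simp add: f_def)
    next
      case 2
      then show ?thesis using that(3) by (simp add: f_def)
    qed
  qed
  define xs where "xs = sorted_list_of_set (f ` A)"
  have xs: "set xs = f ` A" "sorted_wrt (<) xs"
    using assms by (simp_all add: xs_def)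
  define g where "g = inv_into A f"
  have inj: "inj_on f A"
  proof (rule inj_onI)
    fix \<alpha> \<beta> assume *: "\<alpha> \<in> A" "\<beta> \<in> A" "f \<alpha> = f \<beta>"
    have a: "col \<gamma> = f \<gamma> div (N + 1)" "N - row \<gamma> = f \<gamma> mod (N + 1)" for \<gamma>
    proof -
      have "N - row \<gamma> < N + 1" by simp
      then show "col \<gamma> = f \<gamma> div (N + 1)" "N - row \<gamma> = f \<gamma> mod (N + 1)"
        unfolding f_def by (metis add.commute add_cancel_right_left div_less div_mult_self3 gr_zeroI less_zeroE)
          (metis mod_less mod_mult_self3 \<open>N - row \<gamma> < N + 1\<close>)
    qed
    have "col \<alpha> = col \<beta>" "N - row \<alpha> = N - row \<beta>"
      using a *(3) by metis+
    then show "\<alpha> = \<beta>" using N *(1,2) by (metis diff_diff_cancel prod_eqI)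
  qed
  have "A = g ` set xs" by (simp add: xs(1) g_def inj)
  also have "\<dots> = (\<lambda>i. g (xs ! (i - 1))) ` {1..length xs}"
    by (force simp: set_conv_nth image_iff intro: bexI [of _ "Suc _"])
  finally have A: "A = (\<lambda>i. g (xs ! (i - 1))) ` {1..length xs}" .
  have "g (xs ! (i - 1)) \<succ> g (xs ! (j - 1))" if "1 \<le> i" "i < j" "j \<le> length xs" for i j
  proof -
    have "xs ! (i - 1) < xs ! (j - 1)"
      by (rule sorted_wrt_nth_less [OF xs(2)]) (use that in auto)
    moreover have "xs ! (i - 1) \<in> f ` A" "xs ! (j - 1) \<in> f ` A"
      unfolding xs(1) [symmetric] by (rule nth_mem, use that in linarith)+
    ultimately show ?thesis
      by (intro gt) (auto simp: g_def inv_into_into f_inv_into_f)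
  qed
  with A show ?thesis
    by (intro exI [of _ "length xs"] exI [of _ "\<lambda>i. g (xs ! (i - 1))"]) simp
qed

lemma greatest_exists_unique:
  assumes "finite A" "A \<noteq> {}"
  shows "\<exists>!\<alpha>. is_greatest \<alpha> A"
proof -
  obtain c :: nat and \<xi> where A: "A = \<xi> ` {1..c}"
    and gt: "\<And>i j. 1 \<le> i \<and> i < j \<and> j \<le> c \<Longrightarrow> \<xi> i \<succ> \<xi> j"
    using decreasing_enumeration [OF assms(1)] by blast
  have c: "1 \<le> c" using A assms(2) by (cases "c = 0") auto
  have "\<xi> 1 \<succ> \<xi> i" if "i \<in> {1..c}" "\<xi> i \<noteq> \<xi> 1" for i
    using gt [of 1 i] that by (cases "i = 1") auto
  then have "is_greatest (\<xi> 1) A"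
    using c by (auto simp: is_greatest_def A)
  moreover have "\<alpha> = \<beta>" if "is_greatest \<alpha> A" "is_greatest \<beta> A" for \<alpha> \<beta>
    using that unfolding is_greatest_def root_gt_def by (metis less_asym less_irrefl)
  ultimately show ?thesis by blast
qed

lemma greatest_empty_place:
  assumes "empty_places n F \<noteq> {}"
  shows "is_greatest (THE \<xi>. is_greatest \<xi> (empty_places n F)) (empty_places n F)"
  by (rule theI' [OF greatest_exists_unique])
    (use assms in \<open>auto simp: empty_places_def\<close>)

lemma diagram_filled: "empty_places n (diagram n D) = {}"
  unfolding diagram_def
proof (rule while_rule [where P = "\<lambda>_. True" and r = "measure (\<lambda>F. card (empty_places n F))"])
  fix F :: filling
  assume ne: "empty_places n F \<noteq> {}"
  define \<xi> where "\<xi> = (THE \<xi>. is_greatest \<xi> (empty_places n F))"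
  have "\<xi> \<in> empty_places n F"
    using greatest_empty_place [OF ne] by (simp add: \<xi>_def is_greatest_def)
  moreover have "fill_step n F \<xi> = Some Otimes"
    by (simp add: fill_step_def \<xi>_def Let_def)
  moreover have "empty_places n (fill_step n F) \<subseteq> empty_places n F"
    by (auto simp: empty_places_def fill_step_def Let_def split: if_splits)
  ultimately have "empty_places n (fill_step n F) \<subset> empty_places n F"
    unfolding empty_places_def by fastforce
  then show "(fill_step n F, F) \<in> measure (\<lambda>F. card (empty_places n F))"
    by (simp add: psubset_card_mono empty_places_def)
qed auto

lemma w_perm_permutes: "w_perm n D permutes {1..n}"
proof -
  have mem: "w_perm n D j \<in> {1..n} - w_perm n D ` {1..<j}" if j: "j \<in> {1..n}" for j
  proof -
    let ?X = "{i \<in> {1..n}. (i, j) \<notin> M_set n D \<and> i \<notin> w_perm n D ` {1..<j}}"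
    have "card (w_perm n D ` {1..<j}) < card {1..j}"
      using card_image_le [of "{1..<j}" "w_perm n D"] j by (simp, linarith)
    then have "\<not> {1..j} \<subseteq> w_perm n D ` {1..<j}"
      by (metis card_mono finite_atLeastLessThan finite_imageI not_less)
    then obtain i where "i \<in> {1..j}" "i \<notin> w_perm n D ` {1..<j}" by blast
    then have "i \<in> ?X"
      using j by (auto simp: M_set_def regular_roots_def pos_roots_def positive_root_def)
    then have "Max ?X \<in> ?X" by (intro Max_in) auto
    moreover have "w_perm n D j = Max ?X" using j by (subst w_perm.simps) simp
    ultimately show ?thesis by (metis (mono_tags, lifting) DiffI mem_Collect_eq)
  qed
  have "inj_on (w_perm n D) {1..n}"
  proof (rule linorder_inj_onI)
    fix i j assume "i < j" "i \<in> {1..n}" "j \<in> {1..n}"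
    then have "w_perm n D i \<in> w_perm n D ` {1..<j}" by auto
    then show "w_perm n D i \<noteq> w_perm n D j" using mem [OF \<open>j \<in> {1..n}\<close>] by auto
  qed auto
  moreover have "w_perm n D ` {1..n} \<subseteq> {1..n}" using mem by auto
  ultimately have "bij_betw (w_perm n D) {1..n} {1..n}"
    by (simp add: bij_betw_def endo_inj_surj)
  then show ?thesis
    by (rule bij_imp_permutes) (subst w_perm.simps, rule if_not_P)
qed

end

theory Submission
  imports Defs
begin

text \<open>
  Think of \<open>u = r\<^sub>1 \<cdots> r\<^sub>t\<close> as an arrangement of the values \<open>1, \<dots>, n\<close>
  on the positions \<open>1, \<dots>, n\<close>. Multiplying on the right by the reflection in
  \<open>\<xi> = (i, k)\<close> exchanges the values at the positions \<open>i\<close> and \<open>k\<close>, and a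
  positive root \<open>(a, b)\<close> is sent by \<open>u\<close> to a positive root iff the value at \<open>a\<close>
  exceeds the value at \<open>b\<close>.

  The key observation is a description of the arrangement when the filling process
  reaches column \<open>k\<close> (\<open>settled\<close>). A position \<open>i \<ge> k\<close> whose row has no
  root of \<open>D\<close> to the left of column \<open>k\<close> has never been touched and carries the value
  \<open>i\<close>; the other positions \<open>i \<ge> k\<close> carry values smaller than \<open>k\<close>. Outside
  \<open>M(D)\<close>, column \<open>k\<close> only has places of two kinds: those in rows that already
  contain a root of \<open>D\<close>, and those at or above the root of \<open>D\<close> in the column. Hence a
  reflection chosen in column \<open>k\<close> either exchanges values below \<open>k\<close> or belongs to \<open>D\<close>
  itself (\<open>chosen_row_used\<close>), so the description passes to column \<open>k + 1\<close>.

  With it, two things can be read off. First, the marks \<open>+\<close> and \<open>-\<close> record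
  signs (\<open>tracks_step\<close>): the exchange at \<open>(i, k)\<close> makes \<open>(a, k)\<close> and
  \<open>(i, a)\<close> negative when the value at \<open>a\<close> lies between those at \<open>k\<close> and
  \<open>i\<close>, that is, when both were positive; and the diagram fills them when both are empty.
  These conditions could differ only if one of the two places is in \<open>M(D)\<close>, which the
  description of the values excludes. So, from the current column on, the empty places are
  exactly those outside \<open>M(D)\<close> that \<open>u\<close> keeps positive, and since an empty place has
  been empty all along, this gives (i), (ii) and (iii).
  Second, once column \<open>k\<close> is full the value at position \<open>k\<close> is the greatest
  admissible one that is left, which is the recursive definition of \<open>w\<^sub>D\<close>
  (\<open>column_without_D\<close>, \<open>column_with_D\<close>).
\<close>


section \<open>Roots and the set \<open>M(D)\<close>\<close>

lemma pos_roots_iff: "(a, b) \<in> pos_roots n \<longleftrightarrow> 1 \<le> b \<and> b < a \<and> a \<le> n"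
  by (auto simp: pos_roots_def roots_def positive_root_def)

definition used_rows :: "root set \<Rightarrow> nat \<Rightarrow> nat set" where
  "used_rows D k = {i. \<exists>j<k. (i, j) \<in> D}"

lemma used_rows_Suc: "i \<in> used_rows D (Suc k) \<longleftrightarrow> i \<in> used_rows D k \<or> (i, k) \<in> D"
  by (auto simp: used_rows_def less_Suc_eq)

lemma used_rows_mono: "i \<in> used_rows D k \<Longrightarrow> k \<le> l \<Longrightarrow> i \<in> used_rows D l"
  unfolding used_rows_def by (blast intro: order_less_le_trans)

lemma M_set_pos: "(a, b) \<in> M_set n D \<Longrightarrow> (a, b) \<in> pos_roots n"
  by (auto simp: M_set_def regular_roots_def)

text \<open>
  The effect of one step of the filling on the set \<open>E\<close> of empty places, when \<open>(i, k)\<close>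
  receives \<open>\<otimes>\<close>.
\<close>

definition remaining :: "root set \<Rightarrow> nat \<Rightarrow> nat \<Rightarrow> root set" where
  "remaining E i k = E - {(i, k)} -
     (\<Union>a \<in> {a. k < a \<and> a < i \<and> (a, k) \<in> E \<and> (i, a) \<in> E}. {(a, k), (i, a)})"

context
  fixes n :: nat and D :: "root set"
  assumes basic: "basic n D"
begin

lemma D_pos: "(a, b) \<in> D \<Longrightarrow> 1 \<le> b \<and> b < a \<and> a \<le> n"
  using basic unfolding basic_def pos_roots_iff[symmetric] by blast

lemma D_row_unique: "(d, j) \<in> D \<Longrightarrow> (d, k) \<in> D \<Longrightarrow> j = k"
  using basic by (force simp: basic_def inj_on_def)

lemma D_col_unique: "(d, k) \<in> D \<Longrightarrow> (e, k) \<in> D \<Longrightarrow> d = e"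
  using basic by (force simp: basic_def inj_on_def)

lemma D_row_unused: "(d, k) \<in> D \<Longrightarrow> d \<notin> used_rows D k"
  using D_row_unique by (fastforce simp: used_rows_def)

text \<open>
  A root \<open>(a, b)\<close> is \<open>D\<close>-singular iff \<open>D\<close> has a root to its left in the same row or
  below it in the same column: these are the roots that \<open>(a, b)\<close> can be completed to by
  adding a positive root.
\<close>

lemma M_set_iff:
  assumes "(a, b) \<in> pos_roots n"
  shows "(a, b) \<in> M_set n D \<longleftrightarrow> a \<notin> used_rows D (Suc b) \<and> (\<forall>d\<ge>a. (d, b) \<notin> D)"
proof -
  have "(a, b) \<in> singular_roots n D \<longleftrightarrow> a \<in> used_rows D b \<or> (\<exists>d>a. (d, b) \<in> D)"
  proof
    assume "(a, b) \<in> singular_roots n D"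
    then show "a \<in> used_rows D b \<or> (\<exists>d>a. (d, b) \<in> D)"
      by (auto simp: singular_roots_def root_sum_def doubleton_eq_iff used_rows_def)
  next
    assume "a \<in> used_rows D b \<or> (\<exists>d>a. (d, b) \<in> D)"
    then consider j where "j < b" "(a, j) \<in> D" | d where "d > a" "(d, b) \<in> D"
      by (auto simp: used_rows_def)
    then show "(a, b) \<in> singular_roots n D"
    proof cases
      case 1
      then have "root_sum (a, j) (a, b) (b, j)" "(b, j) \<in> pos_roots n"
        using assms D_pos[OF 1(2)] by (auto simp: root_sum_def pos_roots_iff)
      then show ?thesis using 1 assms unfolding singular_roots_def by blast
    next
      case 2
      then have "root_sum (d, b) (a, b) (d, a)" "(d, a) \<in> pos_roots n"
        using assms D_pos[OF 2(2)] by (auto simp: root_sum_def pos_roots_iff doubleton_eq_iff)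
      then show ?thesis using 2 assms unfolding singular_roots_def by blast
    qed
  qed
  then show ?thesis
    using assms by (auto simp: M_set_def regular_roots_def used_rows_Suc order_le_less)
qed

lemma M_set_unused: "(a, b) \<in> M_set n D \<Longrightarrow> a \<notin> used_rows D (Suc b)"
  using M_set_iff M_set_pos by blast


section \<open>The invariants of the column-by-column process\<close>

text \<open>
  The shape of the arrangement \<open>u\<close> when all columns before \<open>k\<close> are done. The definition
  of \<open>w\<^sub>D\<close> asks whether the place (value, \<open>k\<close>) is in \<open>M(D)\<close>, the diagram asks
  this for the place (position, \<open>k\<close>). At untouched positions these are the same place; at the
  others both answers are no, the first because the value is less than \<open>k\<close>, the second because
  \<open>D\<close> has a root further left in the row.
\<close>

definition settled :: "nat \<Rightarrow> (nat \<Rightarrow> nat) \<Rightarrow> bool" where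
  "settled k u \<longleftrightarrow> (\<forall>i\<in>{k..n}. if i \<in> used_rows D k then u i < k else u i = i)"

text \<open>
  Only columns from \<open>c\<close> on are considered: in a column that is already finished a negative
  root may become positive again when a later exchange enlarges the value in its row.
\<close>

definition tracks :: "nat \<Rightarrow> root set \<Rightarrow> (nat \<Rightarrow> nat) \<Rightarrow> bool" where
  "tracks c E u \<longleftrightarrow> (\<forall>a b. (a, b) \<in> pos_roots n \<and> c \<le> b \<longrightarrow>
     ((a, b) \<in> E \<longleftrightarrow> (a, b) \<notin> M_set n D \<and> u b < u a))"

lemma settled_used: "settled k u \<Longrightarrow> k \<le> i \<Longrightarrow> i \<le> n \<Longrightarrow> i \<in> used_rows D k \<Longrightarrow> u i < k"
  unfolding settled_def by (metis atLeastAtMost_iff)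

lemma settled_unused: "settled k u \<Longrightarrow> k \<le> i \<Longrightarrow> i \<le> n \<Longrightarrow> i \<notin> used_rows D k \<Longrightarrow> u i = i"
  unfolding settled_def by (metis atLeastAtMost_iff)

lemma settled_le: "settled k u \<Longrightarrow> k \<le> i \<Longrightarrow> i \<le> n \<Longrightarrow> u i \<le> i"
  using settled_used settled_unused by (metis le_refl less_imp_le order_trans)

lemma tracksD:
  "tracks c E u \<Longrightarrow> (a, b) \<in> pos_roots n \<Longrightarrow> c \<le> b \<Longrightarrow>
     (a, b) \<in> E \<longleftrightarrow> (a, b) \<notin> M_set n D \<and> u b < u a"
  unfolding tracks_def by blast

lemma settled_start: "settled 1 id"
  using D_pos by (fastforce simp: settled_def used_rows_def)

text \<open>
  The value at position \<open>d\<close> is still \<open>d\<close>, and position \<open>k\<close> holds at most \<open>k < d\<close>. In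
  particular a column without empty places at which \<open>u\<close> is settled contains no root of \<open>D\<close>.
\<close>

lemma D_place_empty:
  assumes "settled k u" "tracks c E u" "c \<le> k" "(d, k) \<in> D"
  shows "(d, k) \<in> E"
proof -
  have d: "1 \<le> k" "k < d" "d \<le> n" using D_pos[OF assms(4)] by auto
  have "u d = d" using settled_unused[OF assms(1)] D_row_unused[OF assms(4)] d by simp
  moreover have "u k \<le> k" using settled_le[OF assms(1)] d by simp
  moreover have "(d, k) \<notin> M_set n D" using assms(4) by (simp add: M_set_def)
  ultimately show ?thesis using tracksD[OF assms(2)] assms(3) d by (simp add: pos_roots_iff)
qed

text \<open>
  A place outside \<open>M(D)\<close> in an unused row lies above a root of \<open>D\<close> in its column; that root
  is still empty, and it comes first in the order.
\<close>

lemma chosen_row_used: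
  assumes "settled k u" "tracks c E u" "c \<le> k" "E \<subseteq> pos_roots n"
    and g: "is_greatest (i, k) E"
  shows "i \<in> used_rows D (Suc k)"
proof (rule ccontr)
  assume no: "i \<notin> used_rows D (Suc k)"
  have E: "(i, k) \<in> E" using g by (simp add: is_greatest_def)
  then have p: "(i, k) \<in> pos_roots n" using assms(4) by blast
  have "(i, k) \<notin> M_set n D" using tracksD[OF assms(2) p assms(3)] E by blast
  then obtain d where d: "d \<ge> i" "(d, k) \<in> D" using M_set_iff[OF p] no by blast
  have "d > i" using d no by (cases "d = i") (auto simp: used_rows_Suc)
  moreover have "(d, k) \<in> E" using D_place_empty assms d by blast
  ultimately show False using g by (force simp: is_greatest_def root_gt_def)
qed

text \<open>
  The exchange raises the value at \<open>k\<close> from \<open>u k\<close> to \<open>u i\<close> and lowers the value at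
  \<open>i\<close> correspondingly, so only signs of roots involving \<open>i\<close> or \<open>k\<close> can change. For
  \<open>k < a < i\<close> the places \<open>(a, k)\<close> and \<open>(i, a)\<close> both turn negative if \<open>u a\<close>
  lies between \<open>u k\<close> and \<open>u i\<close>, and otherwise both keep their sign. For \<open>a > i\<close>
  the place \<open>(a, i)\<close> keeps its sign unless \<open>u a\<close> lies in between; but then \<open>(a, k)\<close>
  is outside \<open>M(D)\<close>, since otherwise \<open>u a = a > i \<ge> u i\<close>, and it is a greater empty place.
\<close>

lemma tracks_step:
  assumes S: "settled k u" and T: "tracks c E u" and c: "c \<le> k" and E: "E \<subseteq> pos_roots n"
    and g: "is_greatest (i, k) E" and u: "inj u"
  shows "tracks k (remaining E i k) (u \<circ> Transposition.transpose i k)"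
  unfolding tracks_def
proof (intro allI impI, elim conjE)
  fix a b assume p: "(a, b) \<in> pos_roots n" and kb: "k \<le> b"
  let ?u' = "u \<circ> Transposition.transpose i k"
  have ik: "(i, k) \<in> E" using g by (simp add: is_greatest_def)
  then have pik: "(i, k) \<in> pos_roots n" using E by blast
  then have n: "1 \<le> k" "k < i" "i \<le> n" by (auto simp: pos_roots_iff)
  have ab: "1 \<le> b" "b < a" "a \<le> n" using p by (auto simp: pos_roots_iff)
  have used: "i \<in> used_rows D (Suc k)" using chosen_row_used[OF S T c E g] .
  have up: "u k < u i" using tracksD[OF T pik c] ik by blast
  have Eab: "(a, b) \<in> E \<longleftrightarrow> (a, b) \<notin> M_set n D \<and> u b < u a"
    using tracksD[OF T p] c kb by simp
  have big: "(x, k) \<notin> E" if "x > i" for x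
    using g that by (force simp: is_greatest_def root_gt_def)
  have M_val: "u x = x" if "(x, k) \<in> M_set n D" for x
    using settled_unused[OF S, of x] M_set_unused[OF that] M_set_pos[OF that]
    by (auto simp: used_rows_Suc pos_roots_iff)
  have col: "(x, k) \<in> E \<longleftrightarrow> (x, k) \<notin> M_set n D \<and> u k < u x" if "k < x" "x \<le> n" for x
    using tracksD[OF T, of x k] that n c by (simp add: pos_roots_iff)
  have cases: "i \<in> used_rows D k \<or> (i, k) \<in> D" using used by (simp add: used_rows_Suc)
  consider "b = k" "a = i" | "b = k" "a > i" | "b = k" "a < i" | "b > k" "a = i"
    | "b = i" | "b > k" "a \<noteq> i" "b \<noteq> i"
    using kb by linarith
  then show "(a, b) \<in> remaining E i k \<longleftrightarrow> (a, b) \<notin> M_set n D \<and> ?u' b < ?u' a"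
  proof cases
    case 1
    then show ?thesis using up by (simp add: remaining_def)
  next
    case 2
    then have "(a, b) \<notin> E" using big by simp
    then have "(a, b) \<notin> remaining E i k" by (simp add: remaining_def)
    moreover have "(a, b) \<in> M_set n D \<or> u a \<le> u k"
      using \<open>(a, b) \<notin> E\<close> Eab 2 by auto
    ultimately show ?thesis using 2 n up ab by auto
  next
    case 3
    then have pia: "(i, a) \<in> pos_roots n" using n ab by (simp add: pos_roots_iff)
    \<comment> \<open>row \<open>i\<close> has a root of \<open>D\<close> to the left of column \<open>a\<close>\<close>
    have "(i, a) \<notin> M_set n D"
      using M_set_unused[of i a] used_rows_mono[OF used, of "Suc a"] ab 3 by auto
    then have "(i, a) \<in> E \<longleftrightarrow> u a < u i" using tracksD[OF T pia] c ab 3 by simp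
    moreover have "u a \<noteq> u i" using u 3 by (auto simp: inj_eq)
    ultimately show ?thesis using 3 n ab Eab up
      by (auto simp: remaining_def)
  next
    case 4
    have "u b \<noteq> u k" "u b \<noteq> u i" using u 4 ab by (auto simp: inj_eq)
    \<comment> \<open>a place \<open>(b, k)\<close> of \<open>M(D)\<close> belongs to an untouched position, whose value \<open>b\<close> is too
      large to lie between \<open>u k\<close> and \<open>u i\<close>\<close>
    moreover have "\<not> (u b < u i \<and> (b, k) \<in> M_set n D)"
    proof
      assume *: "u b < u i \<and> (b, k) \<in> M_set n D"
      have pbk: "(b, k) \<in> pos_roots n" using 4 n ab by (simp add: pos_roots_iff)
      have "(i, k) \<notin> D" using * M_set_iff[OF pbk] 4 ab by auto
      then have "u i < k" using cases settled_used[OF S] n by simp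
      then show False using * M_val[of b] 4 by simp
    qed
    ultimately show ?thesis using 4 n ab Eab up col[of b]
      by (auto simp: remaining_def)
  next
    case 5
    then have "a > i" using ab by simp
    have "\<not> (u k < u a \<and> u a < u i)"
    proof
      assume *: "u k < u a \<and> u a < u i"
      then have "(a, k) \<in> M_set n D" using big[OF \<open>a > i\<close>] col[of a] \<open>a > i\<close> ab n by auto
      then have "u a = a" using M_val by simp
      then show False using * \<open>a > i\<close> settled_le[OF S, of i] n by simp
    qed
    moreover have "u a \<noteq> u i" using u \<open>a > i\<close> by (auto simp: inj_eq)
    ultimately show ?thesis using 5 \<open>a > i\<close> n Eab up
      by (auto simp: remaining_def)
  next
    case 6
    then show ?thesis using Eab ab by (auto simp: remaining_def)
  qed
qed

text \<open>
  Here \<open>k\<close> is a used row as well: otherwise \<open>u k = k\<close> would exceed \<open>u i\<close>.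
\<close>

lemma settled_step_used:
  assumes S: "settled k u" and n: "k < i" "i \<le> n" and used: "i \<in> used_rows D k" and up: "u k < u i"
  shows "settled k (u \<circ> Transposition.transpose i k)"
proof -
  have "u i < k" using settled_used[OF S] n used by simp
  then have k: "k \<in> used_rows D k" "u k < k"
    using up settled_unused[OF S, of k] n by fastforce+
  show ?thesis unfolding settled_def
  proof
    fix x assume "x \<in> {k..n}"
    then show "if x \<in> used_rows D k then (u \<circ> Transposition.transpose i k) x < k
      else (u \<circ> Transposition.transpose i k) x = x"
      using settled_used[OF S, of x] settled_unused[OF S, of x] k \<open>u i < k\<close> used
      by (auto simp: Transposition.transpose_def)
  qed
qed

text \<open>
  Row \<open>i\<close> becomes used, and position \<open>i\<close> receives \<open>u k \<le> k\<close>.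
\<close>

lemma settled_step_D:
  assumes S: "settled k u" and ik: "(i, k) \<in> D"
  shows "settled (Suc k) (u \<circ> Transposition.transpose i k)"
proof -
  have n: "k < i" "i \<le> n" using D_pos[OF ik] by auto
  have k: "u k \<le> k" using settled_le[OF S] n by simp
  show ?thesis unfolding settled_def
  proof
    fix x assume "x \<in> {Suc k..n}"
    moreover have "x \<in> used_rows D (Suc k) \<longleftrightarrow> x \<in> used_rows D k \<or> x = i"
      using ik D_col_unique by (auto simp: used_rows_Suc)
    ultimately show "if x \<in> used_rows D (Suc k) then (u \<circ> Transposition.transpose i k) x < Suc k
      else (u \<circ> Transposition.transpose i k) x = x"
      using settled_used[OF S, of x] settled_unused[OF S, of x] k n
      by (auto simp: Transposition.transpose_def)
  qed
qed

lemma settled_advance: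
  assumes S: "settled k u" and noD: "\<And>d. (d, k) \<notin> D"
  shows "settled (Suc k) u"
  unfolding settled_def
proof
  fix x assume "x \<in> {Suc k..n}"
  then show "if x \<in> used_rows D (Suc k) then u x < Suc k else u x = x"
    using settled_used[OF S, of x] settled_unused[OF S, of x] noD by (auto simp: used_rows_Suc)
qed


section \<open>The values of the permutation \<open>w\<^sub>D\<close>\<close>

lemma w_perm_eqI:
  assumes u: "u permutes {1..n}" and k: "k \<in> {1..n}"
    and prev: "\<And>j. 1 \<le> j \<Longrightarrow> j < k \<Longrightarrow> u j = w_perm n D j"
    and M: "(u k, k) \<notin> M_set n D"
    and max: "\<And>p. k < p \<Longrightarrow> p \<le> n \<Longrightarrow> (u p, k) \<notin> M_set n D \<Longrightarrow> u p \<le> u k"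
  shows "u k = w_perm n D k"
proof -
  let ?X = "{i \<in> {1..n}. (i, k) \<notin> M_set n D \<and> i \<notin> w_perm n D ` {1..<k}}"
  have im: "w_perm n D ` {1..<k} = u ` {1..<k}" using prev by (auto intro!: image_cong)
  have "Max ?X = u k"
  proof (rule Max_eqI)
    have "u k \<notin> u ` {1..<k}" using permutes_inj[OF u] by (auto simp: inj_eq)
    moreover have "u k \<in> {1..n}" using permutes_in_image[OF u] k by blast
    ultimately show "u k \<in> ?X" unfolding im using M by simp
  next
    fix y assume y: "y \<in> ?X"
    then obtain p where p: "p \<in> {1..n}" "y = u p" using permutes_image[OF u] by blast
    then have "k \<le> p" using y unfolding im by (auto simp: not_less[symmetric])
    then show "y \<le> u k" using max[of p] y p by (cases "p = k") auto
  qed simp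
  then show ?thesis using k by (subst w_perm.simps) simp
qed

text \<open>
  A larger value that is still available sits at a position \<open>p > k\<close>. If row \<open>p\<close> is used,
  \<open>(p, k)\<close> is outside \<open>M(D)\<close> and not empty, hence negative; if it is unused, the value is
  \<open>p\<close> itself and \<open>(p, k)\<close> lies in \<open>M(D)\<close>, because the column has no root of \<open>D\<close>.
\<close>

lemma column_without_D:
  assumes S: "settled k u" and T: "tracks c E u" "c \<le> k" and none: "\<And>a. (a, k) \<notin> E"
    and u: "u permutes {1..n}" and k: "k \<in> {1..n}"
    and prev: "\<And>j. 1 \<le> j \<Longrightarrow> j < k \<Longrightarrow> u j = w_perm n D j"
  shows "settled (Suc k) u" "u k = w_perm n D k"
proof -
  have noD: "(d, k) \<notin> D" for d using D_place_empty[OF S T] none by blast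
  show "settled (Suc k) u" using settled_advance[OF S noD] .
  show "u k = w_perm n D k"
  proof (rule w_perm_eqI[OF u k])
    show "u j = w_perm n D j" if "1 \<le> j" "j < k" for j using prev that .
    have "u k \<le> k" using settled_le[OF S] k by simp
    then show "(u k, k) \<notin> M_set n D" using M_set_pos by (fastforce simp: pos_roots_iff)
  next
    fix p assume p: "k < p" "p \<le> n" and M: "(u p, k) \<notin> M_set n D"
    have pp: "(p, k) \<in> pos_roots n" using p k by (simp add: pos_roots_iff)
    have "p \<in> used_rows D k"
    proof (rule ccontr)
      assume "p \<notin> used_rows D k"
      moreover from this have "u p = p" using settled_unused[OF S] p by simp
      ultimately show False using M M_set_iff[OF pp] noD by (auto simp: used_rows_Suc)
    qed
    then have "(p, k) \<notin> M_set n D" using M_set_unused by (auto simp: used_rows_Suc)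
    then show "u p \<le> u k" using tracksD[OF T(1) pp T(2)] none by simp
  qed
qed

text \<open>
  Here the value of \<open>w\<^sub>D\<close> at \<open>k\<close> is \<open>i\<close>: all available values greater than \<open>i\<close> sit at
  untouched positions, and their places in column \<open>k\<close> are below the root of \<open>D\<close>, hence in
  \<open>M(D)\<close>.
\<close>

lemma column_with_D:
  assumes S: "settled k u" and ik: "(i, k) \<in> D"
    and u: "u permutes {1..n}"
    and prev: "\<And>j. 1 \<le> j \<Longrightarrow> j < k \<Longrightarrow> u j = w_perm n D j"
  shows "(u \<circ> Transposition.transpose i k) k = w_perm n D k"
proof -
  have n: "1 \<le> k" "k < i" "i \<le> n" using D_pos[OF ik] by auto
  let ?u' = "u \<circ> Transposition.transpose i k"
  have ui: "u i = i" using settled_unused[OF S] D_row_unused[OF ik] n by simp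
  have uk: "u k \<le> k" using settled_le[OF S] n by simp
  have k': "?u' k = i" using ui by simp
  show ?thesis
  proof (rule w_perm_eqI[where u = ?u'])
    show "?u' permutes {1..n}"
      using n u by (intro permutes_compose permutes_swap_id) auto
    show "?u' j = w_perm n D j" if "1 \<le> j" "j < k" for j
      using prev[OF that] that n by simp
    show "(?u' k, k) \<notin> M_set n D" using k' ik by (simp add: M_set_def)
  next
    fix p assume p: "k < p" "p \<le> n" and M: "(?u' p, k) \<notin> M_set n D"
    consider "p = i" | "p \<noteq> i" "p \<in> used_rows D k" | "p \<noteq> i" "p \<notin> used_rows D k" by blast
    then show "?u' p \<le> ?u' k"
    proof cases
      case 1
      then show ?thesis using uk ui n by simp
    next
      case 2
      then show ?thesis using settled_used[OF S, of p] p k' n by simp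
    next
      case 3
      have pp: "(p, k) \<in> pos_roots n" using p n by (simp add: pos_roots_iff)
      have p': "?u' p = p" using settled_unused[OF S, of p] 3 p by simp
      have "(p, k) \<notin> D" using 3 D_col_unique[OF ik] by blast
      then obtain d where "d \<ge> p" "(d, k) \<in> D"
        using M 3 p' M_set_iff[OF pp] by (auto simp: used_rows_Suc)
      then show ?thesis using D_col_unique[OF ik] p' k' by simp
    qed
  qed (use n in auto)
qed

text \<open>
  Two columns are needed: \<open>c\<close> is the column of the last \<open>\<otimes>\<close>, from which on signs are
  tracked, whereas the arrangement is settled at \<open>k\<close>, with \<open>k = c + 1\<close> right after a
  root of \<open>D\<close> has been chosen.
\<close>

definition process_state :: "nat \<Rightarrow> root set \<Rightarrow> (nat \<Rightarrow> nat) \<Rightarrow> bool" where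
  "process_state c E u \<longleftrightarrow> u permutes {1..n} \<and> E \<subseteq> pos_roots n \<and> tracks c E u \<and>
     (\<exists>k\<ge>c. 1 \<le> k \<and> settled k u \<and> (\<forall>p\<in>E. k \<le> col p) \<and>
        (\<forall>j. 1 \<le> j \<and> j < k \<longrightarrow> u j = w_perm n D j))"

lemma process_state_start: "process_state 1 (pos_roots n - M_set n D) id"
  unfolding process_state_def
  by (intro conjI exI[of _ 1]) (use settled_start in
    \<open>auto simp: tracks_def permutes_id pos_roots_iff\<close>)

text \<open>
  A column at which \<open>u\<close> is settled and where no place is empty has no root of \<open>D\<close>, so it
  can be passed without an exchange.
\<close>

lemma process_state_advance:
  assumes P: "process_state c E u" and l: "l \<le> Suc n" and E: "\<And>p. p \<in> E \<Longrightarrow> l \<le> col p"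
  obtains k where "l \<le> k" "c \<le> k" "1 \<le> k" "settled k u" "\<And>p. p \<in> E \<Longrightarrow> k \<le> col p"
    "\<And>j. 1 \<le> j \<Longrightarrow> j < k \<Longrightarrow> u j = w_perm n D j"
proof -
  have u: "u permutes {1..n}" and T: "tracks c E u" using P by (auto simp: process_state_def)
  have "\<exists>k\<ge>l. c \<le> k \<and> 1 \<le> k \<and> settled k u \<and> (\<forall>p\<in>E. k \<le> col p) \<and>
      (\<forall>j. 1 \<le> j \<and> j < k \<longrightarrow> u j = w_perm n D j)"
    using l E
  proof (induction l)
    case 0
    then show ?case using P unfolding process_state_def by blast
  next
    case (Suc l)
    have "l \<le> col p" if "p \<in> E" for p using Suc.prems(2)[OF that] by simp
    then obtain k where k: "k \<ge> l" "c \<le> k" "1 \<le> k" "settled k u" "\<forall>p\<in>E. k \<le> col p"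
      and prev: "\<And>j. 1 \<le> j \<Longrightarrow> j < k \<Longrightarrow> u j = w_perm n D j"
      using Suc by auto
    show ?case
    proof (cases "k = l")
      case False
      then show ?thesis using k prev by (intro exI[of _ k]) auto
    next
      case True
      have none: "(a, k) \<notin> E" for a using Suc.prems(2) True by fastforce
      have "k \<in> {1..n}" using k Suc.prems(1) True by simp
      note * = column_without_D[OF k(4) T k(2) none u this prev]
      have "u j = w_perm n D j" if "1 \<le> j" "j < Suc k" for j
        using *(2) prev[of j] that by (cases "j = k") auto
      then show ?thesis using *(1) True k Suc.prems(2) by (intro exI[of _ "Suc k"]) auto
    qed
  qed
  then show ?thesis using that by blast
qed

lemma process_state_step:
  assumes P: "process_state c E u" and g: "is_greatest (i, k) E" and ck: "c \<le> k"
  shows "process_state k (remaining E i k) (u \<circ> Transposition.transpose i k)"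
proof -
  have u: "u permutes {1..n}" and E: "E \<subseteq> pos_roots n" and T: "tracks c E u"
    using P by (auto simp: process_state_def)
  have ik: "(i, k) \<in> E" using g by (simp add: is_greatest_def)
  then have pik: "(i, k) \<in> pos_roots n" using E by blast
  then have n: "1 \<le> k" "k < i" "i \<le> n" by (auto simp: pos_roots_iff)
  have cols: "k \<le> col p" if "p \<in> E" for p
    using g that by (force simp: is_greatest_def root_gt_def)
  obtain l where "k \<le> l" "settled l u" "\<And>p. p \<in> E \<Longrightarrow> l \<le> col p"
    "\<And>j. 1 \<le> j \<Longrightarrow> j < l \<Longrightarrow> u j = w_perm n D j"
    by (rule process_state_advance[OF P _ cols]) (use n in auto)
  moreover from this have "l = k" using ik by force
  ultimately have S: "settled k u" and prev: "\<And>j. 1 \<le> j \<Longrightarrow> j < k \<Longrightarrow> u j = w_perm n D j"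
    by auto
  let ?u' = "u \<circ> Transposition.transpose i k"
  have u': "?u' permutes {1..n}"
    using n u by (intro permutes_compose permutes_swap_id) auto
  have T': "tracks k (remaining E i k) ?u'"
    by (rule tracks_step[OF S T ck E g permutes_inj[OF u]])
  have sub: "remaining E i k \<subseteq> E" by (auto simp: remaining_def)
  have prev': "?u' j = w_perm n D j" if "1 \<le> j" "j < k" for j
    using prev[OF that] that n by simp
  have "\<exists>l\<ge>k. 1 \<le> l \<and> settled l ?u' \<and> (\<forall>p\<in>remaining E i k. l \<le> col p) \<and>
        (\<forall>j. 1 \<le> j \<and> j < l \<longrightarrow> ?u' j = w_perm n D j)"
  proof (cases "i \<in> used_rows D k")
    case True
    have "u k < u i" using tracksD[OF T pik ck] ik by blast
    then show ?thesis using settled_step_used[OF S n(2,3) True] prev' sub cols n by blast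
  next
    case False
    then have D: "(i, k) \<in> D"
      using chosen_row_used[OF S T ck E g] by (simp add: used_rows_Suc)
    have "u i = i" using settled_unused[OF S] False n by simp
    \<comment> \<open>position \<open>k\<close> now holds \<open>i\<close>, while a position \<open>a\<close> with \<open>k < a < i\<close> holds at most \<open>a\<close>,
      so the column is finished\<close>
    have "Suc k \<le> col p" if p: "p \<in> remaining E i k" for p
    proof (rule ccontr)
      assume "\<not> Suc k \<le> col p"
      then obtain a where a: "p = (a, k)" using cols[of p] p sub by (cases p) auto
      have pa: "(a, k) \<in> pos_roots n" using a p sub E by blast
      have "?u' k < ?u' a" using tracksD[OF T' pa] a p by simp
      moreover have "a \<noteq> i" using a p by (auto simp: remaining_def)
      moreover have "a < i" using g a p sub \<open>a \<noteq> i\<close>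
        by (force simp: is_greatest_def root_gt_def)
      ultimately show False using \<open>u i = i\<close> settled_le[OF S, of a] pa
        by (auto simp: pos_roots_iff)
    qed
    moreover have "?u' j = w_perm n D j" if "1 \<le> j" "j < Suc k" for j
      using prev'[of j] column_with_D[OF S D u prev] that by (cases "j = k") auto
    ultimately show ?thesis using settled_step_D[OF S D] by (intro exI[of _ "Suc k"]) auto
  qed
  then show ?thesis using u' T' E sub unfolding process_state_def by blast
qed

lemma process_state_end:
  assumes "process_state c {} u"
  shows "u = w_perm n D"
proof
  fix j
  obtain k where k: "Suc n \<le> k" "\<And>j. 1 \<le> j \<Longrightarrow> j < k \<Longrightarrow> u j = w_perm n D j"
    using process_state_advance[OF assms, of "Suc n"] by (metis empty_iff le_refl)
  show "u j = w_perm n D j"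
  proof (cases "j \<in> {1..n}")
    case True
    then show ?thesis using k by simp
  next
    case False
    then show ?thesis using assms permutes_not_in[OF w_perm_permutes, of j n D]
      by (metis permutes_not_in process_state_def)
  qed
qed

end


section \<open>The filling of the diagram\<close>

lemma fillable_iff:
  "fillable F (i, k) p q \<longleftrightarrow>
     (\<exists>a. k < a \<and> a < i \<and> p = (a, k) \<and> q = (i, a) \<and> F p = None \<and> F q = None)"
  by (auto simp: fillable_def root_sum_def doubleton_eq_iff)

lemma fill_step_eq:
  assumes g: "is_greatest (i, k) (empty_places n F)"
  shows "fill_step n F \<gamma> =
    (if \<gamma> = (i, k) then Some Otimes
     else if \<exists>\<beta>. fillable F (i, k) \<gamma> \<beta> then Some Plus
     else if \<exists>\<alpha>. fillable F (i, k) \<alpha> \<gamma> then Some Minus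
     else F \<gamma>)"
proof -
  have "empty_places n F \<noteq> {}" using g by (auto simp: is_greatest_def)
  moreover have "finite (empty_places n F)" by (simp add: empty_places_def)
  ultimately have "(THE \<xi>. is_greatest \<xi> (empty_places n F)) = (i, k)"
    using g by (intro the1_equality greatest_exists_unique)
  then show ?thesis by (simp add: fill_step_def Let_def)
qed

lemma empty_places_fill_step:
  assumes g: "is_greatest (i, k) (empty_places n F)"
  shows "empty_places n (fill_step n F) = remaining (empty_places n F) i k"
proof -
  have ik: "(i, k) \<in> pos_roots n" using g by (simp add: is_greatest_def empty_places_def)
  show ?thesis
  proof (rule set_eqI)
    fix \<gamma>
    have "\<gamma> \<in> empty_places n (fill_step n F) \<longleftrightarrow> \<gamma> \<in> empty_places n F \<and> \<gamma> \<noteq> (i, k) \<and>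
        (\<nexists>\<beta>. fillable F (i, k) \<gamma> \<beta>) \<and> (\<nexists>\<alpha>. fillable F (i, k) \<alpha> \<gamma>)"
      by (simp add: empty_places_def fill_step_eq[OF g])
    also have "\<dots> \<longleftrightarrow> \<gamma> \<in> remaining (empty_places n F) i k"
      using ik by (auto simp: empty_places_def remaining_def fillable_iff pos_roots_iff)
    finally show "\<gamma> \<in> empty_places n (fill_step n F) \<longleftrightarrow> \<gamma> \<in> remaining (empty_places n F) i k" .
  qed
qed

lemma otimes_fill_step:
  assumes g: "is_greatest (i, k) (empty_places n F)"
  shows "{\<gamma> \<in> pos_roots n. fill_step n F \<gamma> = Some Otimes} =
    insert (i, k) {\<gamma> \<in> pos_roots n. F \<gamma> = Some Otimes}"
proof -
  have "(i, k) \<in> pos_roots n" using g by (simp add: is_greatest_def empty_places_def)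
  then show ?thesis
    by (auto simp: fill_step_eq[OF g] fillable_iff split: if_splits)
qed

definition filling_at :: "nat \<Rightarrow> root set \<Rightarrow> nat \<Rightarrow> filling" where
  "filling_at n D t = (fill_step n ^^ t) (step0 n D)"

abbreviation empty_at :: "nat \<Rightarrow> root set \<Rightarrow> nat \<Rightarrow> root set" where
  "empty_at n D t \<equiv> empty_places n (filling_at n D t)"

text \<open>
  The place \<open>\<xi>\<^sub>t\<close>; the count starts at \<open>t = 1\<close>, and \<open>\<xi>\<^sub>t\<close> is taken from the
  filling after \<open>t - 1\<close> steps.
\<close>

definition chosen :: "nat \<Rightarrow> root set \<Rightarrow> nat \<Rightarrow> root" where
  "chosen n D t = (THE \<xi>. is_greatest \<xi> (empty_at n D (t - 1)))"

lemma filling_at_Suc: "filling_at n D (Suc t) = fill_step n (filling_at n D t)"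
  by (simp add: filling_at_def)

lemma chosen_greatest:
  "empty_at n D t \<noteq> {} \<Longrightarrow> is_greatest (chosen n D (Suc t)) (empty_at n D t)"
  unfolding chosen_def using greatest_empty_place by simp

lemma empty_at_Suc:
  assumes "empty_at n D t \<noteq> {}"
  shows "empty_at n D (Suc t) =
    remaining (empty_at n D t) (row (chosen n D (Suc t))) (col (chosen n D (Suc t)))"
  unfolding filling_at_Suc
  by (rule empty_places_fill_step) (use chosen_greatest[OF assms] in simp)

lemma diagram_reached:
  "\<exists>N. diagram n D = filling_at n D N \<and> (\<forall>t<N. empty_at n D t \<noteq> {})"
proof -
  let ?P = "\<lambda>F. \<exists>N. F = filling_at n D N \<and> (\<forall>t<N. empty_at n D t \<noteq> {})"
  show "?P (diagram n D)"
    unfolding diagram_def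
  proof (rule while_rule[where P = ?P and r = "measure (\<lambda>F. card (empty_places n F))"])
    show "?P (step0 n D)" by (intro exI[of _ 0]) (simp add: filling_at_def)
  next
    fix F assume "?P F" and ne: "empty_places n F \<noteq> {}"
    then obtain N where "F = filling_at n D N" "\<forall>t<N. empty_at n D t \<noteq> {}" by blast
    then show "?P (fill_step n F)"
      using ne by (intro exI[of _ "Suc N"]) (auto simp: filling_at_Suc less_Suc_eq)
  next
    fix F assume ne: "empty_places n F \<noteq> {}"
    then obtain i k where g: "is_greatest (i, k) (empty_places n F)"
      using greatest_empty_place by (metis prod.collapse)
    then have "remaining (empty_places n F) i k \<subset> empty_places n F"
      by (auto simp: remaining_def is_greatest_def)
    then show "(fill_step n F, F) \<in> measure (\<lambda>F. card (empty_places n F))"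
      using psubset_card_mono[of "empty_places n F"]
      by (simp add: empty_places_fill_step[OF g]) (simp add: empty_places_def)
  qed auto
qed

lemma empty_at_antimono:
  assumes "s \<le> t" "\<And>r. r < t \<Longrightarrow> empty_at n D r \<noteq> {}"
  shows "empty_at n D t \<subseteq> empty_at n D s"
  using assms
proof (induction t rule: dec_induct)
  case (step t)
  then have "empty_at n D (Suc t) \<subseteq> empty_at n D t"
    by (subst empty_at_Suc) (auto simp: remaining_def)
  then show ?case using step by auto
qed simp

lemma chosen_gt_empty:
  assumes s: "1 \<le> s" "s \<le> t" and ne: "\<And>r. r < t \<Longrightarrow> empty_at n D r \<noteq> {}"
    and p: "p \<in> empty_at n D t"
  shows "chosen n D s \<succ> p"
proof -
  obtain r where r: "s = Suc r" using s by (cases s) auto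
  have E: "empty_at n D r \<noteq> {}" using ne s r by simp
  have "p \<in> empty_at n D s" using empty_at_antimono[OF s(2) ne] p by blast
  then have "p \<noteq> chosen n D s" "p \<in> empty_at n D r"
    unfolding r empty_at_Suc[OF E] by (auto simp: remaining_def)
  then show ?thesis using chosen_greatest[OF E] r by (simp add: is_greatest_def)
qed

lemma otimes_at:
  assumes "\<And>r. r < t \<Longrightarrow> empty_at n D r \<noteq> {}"
  shows "{\<gamma> \<in> pos_roots n. filling_at n D t \<gamma> = Some Otimes} = chosen n D ` {1..t}"
  using assms
proof (induction t)
  case 0
  then show ?case by (auto simp: filling_at_def step0_def)
next
  case (Suc t)
  have g: "is_greatest (row (chosen n D (Suc t)), col (chosen n D (Suc t))) (empty_at n D t)"
    using chosen_greatest Suc.prems by simp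
  show ?case
    unfolding filling_at_Suc using otimes_fill_step[OF g] Suc by (simp add: atLeastAtMostSuc_conv)
qed

lemma process_state_at:
  assumes basic: "basic n D" and "\<And>r. r < t \<Longrightarrow> empty_at n D r \<noteq> {}"
  shows "process_state n D (if t = 0 then 1 else col (chosen n D t)) (empty_at n D t)
    (refl_prod (chosen n D) t)"
  using assms(2)
proof (induction t)
  case 0
  have "empty_at n D 0 = pos_roots n - M_set n D"
    by (auto simp: empty_places_def filling_at_def step0_def)
  then show ?case using process_state_start[OF basic] by (simp add: id_def)
next
  case (Suc t)
  let ?c = "if t = 0 then 1 else col (chosen n D t)"
  let ?x = "chosen n D (Suc t)"
  have P: "process_state n D ?c (empty_at n D t) (refl_prod (chosen n D) t)"
    using Suc by simp
  have g: "is_greatest (row ?x, col ?x) (empty_at n D t)"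
    using chosen_greatest Suc.prems by simp
  then have "?x \<in> empty_at n D t" by (simp add: is_greatest_def)
  then have "?c \<le> col ?x" using P unfolding process_state_def[OF basic] by (meson le_trans)
  from process_state_step[OF basic P g this] show ?case
    using Suc.prems by (simp add: empty_at_Suc reflection_def o_def)
qed

text \<open>
  The link between the diagram and signs; the condition on the column of \<open>p\<close> holds for every
  root that is less than the last chosen place.
\<close>

lemma empty_at_iff:
  assumes "basic n D" "\<And>r. r < t \<Longrightarrow> empty_at n D r \<noteq> {}"
    and p: "p \<in> pos_roots n" and c: "t = 0 \<or> col (chosen n D t) \<le> col p"
  shows "p \<in> empty_at n D t \<longleftrightarrow>
    p \<notin> M_set n D \<and> act (refl_prod (chosen n D) t) p \<in> pos_roots n"
proof -
  obtain a b where ab: "p = (a, b)" by (cases p)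
  let ?u = "refl_prod (chosen n D) t"
  let ?c = "if t = 0 then 1 else col (chosen n D t)"
  have P: "process_state n D ?c (empty_at n D t) ?u"
    using process_state_at[OF assms(1,2)] .
  have pab: "(a, b) \<in> pos_roots n" using p ab by simp
  have "?c \<le> b" using c ab pab by (auto simp: pos_roots_iff)
  then have "(a, b) \<in> empty_at n D t \<longleftrightarrow> (a, b) \<notin> M_set n D \<and> ?u b < ?u a"
    using P tracksD[OF assms(1) _ pab] unfolding process_state_def[OF assms(1)] by blast
  moreover have "?u a \<in> {1..n}" "?u b \<in> {1..n}"
    using P pab permutes_in_image[of ?u "{1..n}"]
    unfolding process_state_def[OF assms(1)] by (auto simp: pos_roots_iff)
  ultimately show ?thesis using ab by (auto simp: act_def pos_roots_iff)
qed

text \<open>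
  Places are never emptied, so a place that is empty now was positive at every earlier stage.
\<close>

lemma empty_place_act_pos:
  assumes "basic n D" "\<And>r. r < t \<Longrightarrow> empty_at n D r \<noteq> {}" "p \<in> empty_at n D t" "s \<le> t"
  shows "act (refl_prod (chosen n D) s) p \<in> pos_roots n" "p \<notin> M_set n D"
proof -
  have ps: "p \<in> empty_at n D s" using empty_at_antimono[OF assms(4,2)] assms(3) by blast
  have ne: "empty_at n D r \<noteq> {}" if "r < s" for r using assms(2,4) that by simp
  have "s = 0 \<or> col (chosen n D s) \<le> col p"
    using chosen_gt_empty[OF _ order_refl ne ps] by (cases "s = 0") (auto simp: root_gt_def Suc_le_eq)
  moreover have "p \<in> pos_roots n" using ps by (simp add: empty_places_def)
  ultimately show "act (refl_prod (chosen n D) s) p \<in> pos_roots n" "p \<notin> M_set n D"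
    using empty_at_iff[OF assms(1) ne] ps by blast+
qed


section \<open>The decomposition\<close>

lemma refl_prod_cong:
  "(\<And>i. 1 \<le> i \<Longrightarrow> i \<le> m \<Longrightarrow> \<xi> i = \<zeta> i) \<Longrightarrow> refl_prod \<xi> m = refl_prod \<zeta> m"
  by (induction m) auto

lemma decreasing_enumeration_unique:
  fixes \<xi> \<zeta> :: "nat \<Rightarrow> root"
  assumes im: "\<xi> ` {1..c} = \<zeta> ` {1..N}"
    and \<xi>: "\<And>i j. 1 \<le> i \<Longrightarrow> i < j \<Longrightarrow> j \<le> c \<Longrightarrow> \<xi> i \<succ> \<xi> j"
    and \<zeta>: "\<And>i j. 1 \<le> i \<Longrightarrow> i < j \<Longrightarrow> j \<le> N \<Longrightarrow> \<zeta> i \<succ> \<zeta> j"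
  shows "c = N" "\<And>j. 1 \<le> j \<Longrightarrow> j \<le> c \<Longrightarrow> \<xi> j = \<zeta> j"
proof -
  have irrefl: "\<not> \<alpha> \<succ> \<alpha>" and asym: "\<alpha> \<succ> \<beta> \<Longrightarrow> \<not> \<beta> \<succ> \<alpha>" for \<alpha> \<beta>
    by (auto simp: root_gt_def)
  have "\<xi> i \<noteq> \<xi> j" if "1 \<le> i" "i < j" "j \<le> c" for i j
    using \<xi>[OF that] irrefl by metis
  moreover have "\<zeta> i \<noteq> \<zeta> j" if "1 \<le> i" "i < j" "j \<le> N" for i j
    using \<zeta>[OF that] irrefl by metis
  ultimately have inj: "inj_on \<xi> {1..c}" "inj_on \<zeta> {1..N}"
    by (auto intro!: linorder_inj_onI)
  then show "c = N" using im by (metis card_atLeastAtMost card_image diff_Suc_1)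
  show "\<xi> j = \<zeta> j" if "1 \<le> j" "j \<le> c" for j
    using that
  proof (induction j rule: less_induct)
    case (less j)
    have "\<xi> j \<in> \<zeta> ` {1..N}" "\<zeta> j \<in> \<xi> ` {1..c}" using im less.prems \<open>c = N\<close> by auto
    then obtain a b where a: "1 \<le> a" "a \<le> N" "\<xi> j = \<zeta> a" and b: "1 \<le> b" "b \<le> c" "\<zeta> j = \<xi> b"
      by auto
    have "\<not> a < j"
      using less a inj(1) \<open>c = N\<close> by (metis atLeastAtMost_iff inj_onD less_irrefl)
    moreover have "\<not> b < j"
      using less b inj(2) \<open>c = N\<close> by (metis atLeastAtMost_iff inj_onD less_irrefl)
    ultimately consider "a = j" | "b = j" | "j < a" "j < b" by linarith
    then show ?case
    proof cases
      case 3
      have "\<zeta> j \<succ> \<zeta> a" using \<zeta>[of j a] 3 a(2) less.prems(1) by blast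
      moreover have "\<xi> j \<succ> \<xi> b" using \<xi>[of j b] 3 b(2) less.prems(1) by blast
      ultimately show ?thesis using a(3) b(3) asym by metis
    qed (use a b in auto)
  qed
qed

theorem theorem1p7:
  fixes n c :: nat and D :: "root set" and \<xi> :: "nat \<Rightarrow> root"
  assumes "n \<ge> 1"
    and "basic n D"
    and "C_set n D = \<xi> ` {1..c}"
    and "\<forall>i j. 1 \<le> i \<and> i < j \<and> j \<le> c \<longrightarrow> \<xi> i \<succ> \<xi> j"
  shows "w_perm n D = refl_prod \<xi> c \<and>
    (\<forall>j \<in> {1..c}.
       (\<forall>i. 1 \<le> i \<and> i < j \<longrightarrow> act (refl_prod \<xi> i) (\<xi> j) \<in> pos_roots n) \<and>
       \<xi> j \<notin> M_set n D \<and>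
       is_greatest (\<xi> j)
         {\<eta> \<in> pos_roots n.
            (\<forall>i. 1 \<le> i \<and> i < j \<longrightarrow> act (refl_prod \<xi> i) \<eta> \<in> pos_roots n) \<and>
            \<eta> \<notin> M_set n D \<and>
            (j > 1 \<longrightarrow> \<xi> (j - 1) \<succ> \<eta>)})"
proof -
  let ?\<zeta> = "chosen n D"
  obtain N where diag: "diagram n D = filling_at n D N"
    and ne: "\<And>t. t < N \<Longrightarrow> empty_at n D t \<noteq> {}"
    using diagram_reached[of n D] by blast
  have empty: "empty_at n D N = {}" using diagram_filled[of n D] diag by simp
  have next_place: "?\<zeta> (Suc t) \<in> empty_at n D t" if "t < N" for t
    using chosen_greatest[OF ne[OF that]] by (simp add: is_greatest_def)
  have dec: "?\<zeta> i \<succ> ?\<zeta> j" if ij: "1 \<le> i" "i < j" "j \<le> N" for i j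
  proof -
    obtain t where t: "j = Suc t" using ij by (cases j) auto
    show ?thesis unfolding t
      by (rule chosen_gt_empty[of i t]) (use ij t ne next_place in auto)
  qed
  have "\<xi> ` {1..c} = ?\<zeta> ` {1..N}"
    using assms(3) otimes_at[of N n D, OF ne] diag by (simp add: C_set_def)
  moreover have "\<xi> i \<succ> \<xi> j" if "1 \<le> i" "i < j" "j \<le> c" for i j
    using assms(4) that by blast
  ultimately have eq: "c = N" "\<And>j. 1 \<le> j \<Longrightarrow> j \<le> c \<Longrightarrow> \<xi> j = ?\<zeta> j"
    using decreasing_enumeration_unique[of \<xi> c ?\<zeta> N] dec by blast+
  have c: "c = N" and \<xi>: "\<And>j. 1 \<le> j \<Longrightarrow> j \<le> N \<Longrightarrow> \<xi> j = ?\<zeta> j"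
    using eq(1) eq(2) by simp_all
  have prod: "refl_prod \<xi> m = refl_prod ?\<zeta> m" if "m \<le> N" for m
    using \<xi> that by (intro refl_prod_cong) auto
  have "refl_prod \<xi> c = w_perm n D"
    unfolding c prod[OF order_refl]
    by (rule process_state_end[OF assms(2)], subst empty[symmetric],
        rule process_state_at[OF assms(2) ne])
  moreover have "(\<forall>i. 1 \<le> i \<and> i < j \<longrightarrow> act (refl_prod \<xi> i) (\<xi> j) \<in> pos_roots n) \<and>
       \<xi> j \<notin> M_set n D \<and>
       is_greatest (\<xi> j)
         {\<eta> \<in> pos_roots n.
            (\<forall>i. 1 \<le> i \<and> i < j \<longrightarrow> act (refl_prod \<xi> i) \<eta> \<in> pos_roots n) \<and>
            \<eta> \<notin> M_set n D \<and>
            (j > 1 \<longrightarrow> \<xi> (j - 1) \<succ> \<eta>)}"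
    (is "?pos \<and> ?M \<and> is_greatest _ ?A") if j: "j \<in> {1..c}" for j
  proof -
    define t where "t = j - 1"
    have t: "j = Suc t" "t < N" using j c unfolding t_def atLeastAtMost_iff by linarith+
    have ne_t: "empty_at n D r \<noteq> {}" if "r < t" for r using ne that t by simp
    have \<xi>j: "\<xi> j = ?\<zeta> (Suc t)" using \<xi> t by simp
    have in_E: "\<xi> j \<in> empty_at n D t" using next_place t \<xi>j by simp
    have pos: ?pos
      using empty_place_act_pos(1)[OF assms(2) ne_t in_E] prod t by simp
    have M: ?M using empty_place_act_pos(2)[OF assms(2) ne_t in_E order_refl] .
    have "\<xi> (j - 1) \<succ> \<xi> j" if "j > 1" using assms(4) that t c by simp
    then have mem: "\<xi> j \<in> ?A" using pos M in_E by (auto simp: empty_places_def)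
    \<comment> \<open>positivity under \<open>w\<^sub>t\<close> alone, the last of the conditions (i), already forces emptiness\<close>
    have "?A \<subseteq> empty_at n D t"
    proof
      fix \<eta> assume \<eta>: "\<eta> \<in> ?A"
      show "\<eta> \<in> empty_at n D t"
      proof (cases "t = 0")
        case True
        then show ?thesis using \<eta> empty_at_iff[OF assms(2), where t = 0 and p = \<eta>] by (auto simp: act_def)
      next
        case False
        then have "act (refl_prod \<xi> t) \<eta> \<in> pos_roots n" "\<xi> t \<succ> \<eta>" using \<eta> t(1) by auto
        then have "?\<zeta> t \<succ> \<eta>" "act (refl_prod ?\<zeta> t) \<eta> \<in> pos_roots n"
          using False t(2) \<xi>[of t] prod[of t] by auto
        then show ?thesis
          using \<eta> empty_at_iff[OF assms(2) ne_t, where p = \<eta>] by (auto simp: root_gt_def)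
      qed
    qed
    then have "is_greatest (\<xi> j) ?A"
      using mem chosen_greatest[OF ne[OF t(2)]] unfolding \<xi>j is_greatest_def by blast
    then show ?thesis using pos M by blast
  qed
  ultimately show ?thesis by auto
qed

end
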